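(* Let $\nu\in(0,\frac1{10})$. There exist constants $C_{\mathrm{reg}},C_{\mathrm{gr}}\geq 0$ and $\alpha\in(0,1)$, depending only on $\nu$, such that the following holds. Let $h\in(0,\frac1{100})$ and let $\mathbf Y\subset B(0,h^{-1})\subset\mathbb R^2$ be $\nu$-porous on lines on scales $1$ to $h^{-1}$. Then there exists a weight $\omega=\sum_{k\geq 1}\omega_k$, where $\omega_k\in C_c^\infty(\mathbb R^2;(-\infty,0])$ for each $k\in\mathbb N$, $k\ge 1$, such that: (i) $\omega_k=0$ for all $k$ large enough; (ii) $\operatorname{supp}\omega_k\subset\{\mathbf x\in\mathbb R^2: 2^{k-1}\leq|\mathbf x|\leq 2^{k+1}\}$ for all $k\ge1$; (iii) $\|\omega_k\|_{S^1_3}\leq C_{\mathrm{reg}}$ for all $k\geq 1$; (iv) $\sum_{k=1}^\infty q_k\leq C_{\mathrm{gr}}$, where $q_k:=-\inf_{\theta\in\mathbb S^1}T(|\mathbf x|^{-2}\omega_k)(0,\theta)$; (v) $\omega(\mathbf x)\leq -\dfrac{|\mathbf x|}{(\log|\mathbf x|)^\alpha}$ for all $\mathbf x\in\mathbf Y\setminus B(0,10)$.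
   Context: $B(\mathbf x,r)$ denotes the ball of radius $r$ centered at $\mathbf x$. Porosity on lines: for $0<\rho_0\leq\rho_1$ and $\nu\in(0,\frac1{10})$, a set $\mathbf X\subset\mathbb R^d$ is $\nu$-porous on lines on scales $\rho_0$ to $\rho_1$ if for each line segment $\tau\subset\mathbb R^d$ of length $R\in[\rho_0,\rho_1]$ there exists $\mathbf x\in\tau$ such that $\mathbf X\cap B(\mathbf x,\nu R)=\emptyset$. Kohn--Nirenberg norm: for $\psi\in C_c^\infty(\mathbb R^2)$, with $\langle\mathbf x\rangle:=\sqrt{1+|\mathbf x|^2}$, $$\|\psi\|_{S^1_3}:=\max_{|\gamma|\leq 3}\sup_{\mathbf x\in\mathbb R^2}\big|\langle\mathbf x\rangle^{|\gamma|-1}\partial^\gamma_{\mathbf x}\psi(\mathbf x)\big|,$$ where $\gamma$ ranges over multiindices. X-ray transform: for $\psi\in C_c^\infty(\mathbb R^2)$, $s\in\mathbb R$, $\theta\in\mathbb S^1=\mathbb R/2\pi\mathbb Z$, $$T\psi(s,\theta):=\int_{\mathbb R}\psi(t\cos\theta-s\sin\theta,\,t\sin\theta+s\cos\theta)\,dt.$$ Here $|\mathbf x|^{-2}\omega_k$ denotes the function $\mathbf x\mapsto|\mathbf x|^{-2}\omega_k(\mathbf x)$, which is in $C_c^\infty(\mathbb R^2)$ since $\omega_k$ vanishes near $0$. *)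

theory Defs
  imports "HOL-Analysis.Analysis"
begin

definition porous_on_lines :: "real \<Rightarrow> 'a::euclidean_space set \<Rightarrow> real \<Rightarrow> real \<Rightarrow> bool" where
  "porous_on_lines \<nu> X \<rho>\<^sub>0 \<rho>\<^sub>1 \<longleftrightarrow>
     (\<forall>a b. \<rho>\<^sub>0 \<le> dist a b \<and> dist a b \<le> \<rho>\<^sub>1 \<longrightarrow>
       (\<exists>x\<in>closed_segment a b. X \<inter> ball x (\<nu> * dist a b) = {}))"

definition partial_deriv :: "'n::finite \<Rightarrow> (real^'n \<Rightarrow> real) \<Rightarrow> real^'n \<Rightarrow> real" where
  "partial_deriv i f x = deriv (\<lambda>t. f (x + t *\<^sub>R axis i 1)) 0"

primrec C_diff :: "nat \<Rightarrow> (real^'n::finite \<Rightarrow> real) \<Rightarrow> bool" where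
  "C_diff 0 f \<longleftrightarrow> continuous_on UNIV f"
| "C_diff (Suc n) f \<longleftrightarrow> f differentiable_on UNIV \<and> (\<forall>i. C_diff n (partial_deriv i f))"

definition supp :: "('a::topological_space \<Rightarrow> real) \<Rightarrow> 'a set" where
  "supp f = closure (support_on UNIV f)"

definition Cc_infinity :: "(real^'n::finite \<Rightarrow> real) set" where
  "Cc_infinity = {f. (\<forall>n. C_diff n f) \<and> compact (supp f)}"

definition japanese_bracket :: "'a::real_normed_vector \<Rightarrow> real" where
  "japanese_bracket x = sqrt (1 + (norm x)\<^sup>2)"

text \<open>Multiindices on the plane are pairs \<open>(i, j)\<close>. The exponent \<open>i + j - 1\<close> may be \<open>-1\<close>,
  hence the integer power. The suprema are taken in the reals, so the value is
  only meaningful when they are finite, in particular on \<^const>\<open>Cc_infinity\<close>.\<close>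

definition S13_norm :: "(real^2 \<Rightarrow> real) \<Rightarrow> real" where
  "S13_norm \<psi> =
     Max ((\<lambda>(i, j). SUP x. \<bar>japanese_bracket x powi (int (i + j) - 1) *
             (partial_deriv 1 ^^ i) ((partial_deriv 2 ^^ j) \<psi>) x\<bar>)
          ` {(i, j). i + j \<le> (3::nat)})"

text \<open>The circle variable is represented by a real angle; the transform is \<open>2\<pi>\<close>-periodic in it.\<close>

definition xray :: "(real^2 \<Rightarrow> real) \<Rightarrow> real \<Rightarrow> real \<Rightarrow> real" where
  "xray \<psi> s \<theta> =
     (LINT t|lborel. \<psi> (vector [t * cos \<theta> - s * sin \<theta>, t * sin \<theta> + s * cos \<theta>]))"

text \<open>The quantity \<open>q\<^sub>k\<close> attached to \<open>\<omega>\<^sub>k\<close>. Division by zero at the origin is harmless: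
  it is only used for functions vanishing near the origin.\<close>

definition xray_growth :: "(real^2 \<Rightarrow> real) \<Rightarrow> real" where
  "xray_growth w = - (INF \<theta>\<in>{0..<2*pi}. xray (\<lambda>x. w x / (norm x)\<^sup>2) 0 \<theta>)"

end

theory Submission
  imports Defs
begin

text \<open>
  The scales can be treated separately: the regularity bound is uniform in \<open>k\<close>, and the growth
  bound only asks that the \<open>q\<^sub>k\<close> be summable. Without porosity one would take
  \<open>\<omega>\<^sub>k\<close> of size \<open>2\<^sup>k k\<^sup>-\<^sup>\<alpha>\<close> on the whole annulus; then \<open>q\<^sub>k\<close> is of size
  \<open>k\<^sup>-\<^sup>\<alpha>\<close>, which is not summable for \<open>\<alpha> < 1\<close>. Instead, \<open>\<omega>\<^sub>k\<close> is \<open>-A\<close> times a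
  smoothed indicator function of a neighbourhood of \<open>Y\<close> of width comparable to \<open>r\<close>, where
  \<open>A = 5 \<cdot> 2\<^sup>k k\<^sup>-\<^sup>\<alpha>\<close> and \<open>r\<close> is of size \<open>2\<^sup>k k powr (-\<alpha>/3)\<close>.

  Up to three derivatives cost at most \<open>(2\<^sup>k/r)\<^sup>3\<close>, which is of size \<open>k powr \<alpha>\<close>, relative
  to the scale \<open>2\<^sup>k\<close>; this is exactly what the small amplitude \<open>A\<close> pays for
  (\<open>weight_S13_norm_le\<close>).

  Porosity on lines says that, when a segment is divided into \<open>M > 2/\<nu>\<close> equal pieces, one of the
  pieces stays away from \<open>Y\<close> (\<open>porous_on_lines_gap\<close>). Repeating this from scale \<open>2\<^sup>k\<close>
  down to scale \<open>r\<close> shows that, inside the annulus, a line through the origin meets this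
  neighbourhood in a set of measure at most a constant times \<open>2\<^sup>k (r/2\<^sup>k) powr \<gamma>\<close>, with
  \<open>\<gamma> = - log M ((M - 1)/M) > 0\<close> (\<open>measure_le_of_gaps\<close>). So \<open>q\<^sub>k\<close> is at most a
  constant times \<open>k powr (-\<alpha> - \<alpha> \<gamma>/3)\<close> (\<open>weight_xray_growth_le\<close>). This is summable for
  some \<open>\<alpha> < 1\<close>.

  The smoothed indicator function is a finite sum of product bumps \<open>b(x\<^sub>1/r - p) b(x\<^sub>2/r - q)\<close>
  centred at the points of a square lattice, so that all partial derivatives are explicit and
  boundedly many bumps overlap.
\<close>

section \<open>A smooth bump on the line\<close>

text \<open>\<open>times_differentiable n f\<close>: the derivatives of \<open>f\<close> up to order \<open>n\<close> exist on the
  whole line.\<close>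

primrec times_differentiable :: "nat \<Rightarrow> (real \<Rightarrow> real) \<Rightarrow> bool" where
  "times_differentiable 0 f \<longleftrightarrow> True"
| "times_differentiable (Suc n) f \<longleftrightarrow>
     (\<forall>x. f field_differentiable at x) \<and> times_differentiable n (deriv f)"

lemma times_differentiable_Suc_imp: "times_differentiable (Suc n) f \<Longrightarrow> times_differentiable n f"
  by (induction n arbitrary: f) auto

lemma times_differentiable_add:
  "times_differentiable n f \<Longrightarrow> times_differentiable n g \<Longrightarrow> times_differentiable n (\<lambda>x. f x + g x)"
proof (induction n arbitrary: f g)
  case (Suc n)
  then have "deriv (\<lambda>x. f x + g x) = (\<lambda>x. deriv f x + deriv g x)"
    by (intro ext deriv_add) auto
  with Suc show ?case
    by (auto intro!: field_differentiable_add)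
qed simp

lemma times_differentiable_mult:
  "times_differentiable n f \<Longrightarrow> times_differentiable n g \<Longrightarrow> times_differentiable n (\<lambda>x. f x * g x)"
proof (induction n arbitrary: f g)
  case (Suc n)
  then have "deriv (\<lambda>x. f x * g x) = (\<lambda>x. f x * deriv g x + deriv f x * g x)"
    by (intro ext deriv_mult) auto
  moreover have "times_differentiable n f" "times_differentiable n g"
    using Suc.prems times_differentiable_Suc_imp by blast+
  ultimately show ?case
    using Suc by (auto intro!: field_differentiable_mult times_differentiable_add)
qed simp

lemma times_differentiable_affine:
  "times_differentiable n f \<Longrightarrow> times_differentiable n (\<lambda>x. c * f (a * x + b))"
proof (induction n arbitrary: f c)
  case (Suc n)
  have D: "((\<lambda>x. c * f (a * x + b)) has_real_derivative (c * a) * deriv f (a * x + b)) (at x)" for x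
  proof -
    have "(f has_real_derivative deriv f (a * x + b)) (at (a * x + b))"
      using Suc.prems by (simp add: DERIV_deriv_iff_field_differentiable)
    then have "((\<lambda>x. f (a * x + b)) has_real_derivative deriv f (a * x + b) * a) (at x)"
      by (rule DERIV_chain2[where f = f]) (auto intro!: derivative_eq_intros)
    from DERIV_cmult[OF this, of c] show ?thesis by (simp add: mult_ac)
  qed
  then have "deriv (\<lambda>x. c * f (a * x + b)) = (\<lambda>x. (c * a) * deriv f (a * x + b))"
    by (intro ext DERIV_imp_deriv)
  with Suc D show ?case
    by (auto simp: field_differentiable_def)
qed simp

text \<open>Functions of one real variable that are infinitely differentiable on the whole line.\<close>

definition smooth_real :: "(real \<Rightarrow> real) \<Rightarrow> bool" where
  "smooth_real f \<longleftrightarrow> (\<forall>n. times_differentiable n f)"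

lemma smooth_real_deriv: "smooth_real f \<Longrightarrow> smooth_real (deriv f)"
  unfolding smooth_real_def using times_differentiable.simps(2) by blast

lemma smooth_real_has_derivative:
  "smooth_real f \<Longrightarrow> (f has_real_derivative deriv f x) (at x)"
  unfolding smooth_real_def DERIV_deriv_iff_field_differentiable
  using times_differentiable.simps(2) by blast

lemma smooth_real_funpow_deriv: "smooth_real f \<Longrightarrow> smooth_real ((deriv ^^ i) f)"
  by (induction i) (auto intro: smooth_real_deriv)

lemma smooth_real_continuous: "smooth_real f \<Longrightarrow> continuous_on A f"
  by (meson DERIV_isCont continuous_at_imp_continuous_on smooth_real_has_derivative)

text \<open>The functions \<open>P(1/x) exp(-1/x)\<close> with \<open>P\<close> a polynomial, extended by zero to
  \<open>x \<le> 0\<close>. This family contains \<open>exp(-1/x)\<close> and is closed under differentiation,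
  so all its members are smooth, also at the origin.\<close>

definition flat :: "real poly \<Rightarrow> real \<Rightarrow> real" where
  "flat P x = (if x > 0 then poly P (inverse x) * exp (- inverse x) else 0)"

lemma poly_times_exp_tendsto_0: "((\<lambda>y. poly P y * exp (- y)) \<longlongrightarrow> 0) at_top" for P :: "real poly"
proof -
  have "((\<lambda>y::real. \<Sum>i\<le>degree P. coeff P i * (y ^ i / exp y)) \<longlongrightarrow> (\<Sum>i\<le>degree P. coeff P i * 0)) at_top"
    by (intro tendsto_intros tendsto_power_div_exp_0)
  then show ?thesis
    by (simp add: poly_altdef sum_distrib_right exp_minus divide_inverse mult.assoc)
qed

lemma flat_has_derivative:
  "(flat P has_real_derivative flat ([:0, 0, 1:] * (P - pderiv P)) x) (at x)"
proof -
  consider "x > 0" | "x < 0" | "x = 0" by linarith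
  then show ?thesis
  proof cases
    case 1
    have "((\<lambda>x. poly P (inverse x) * exp (- inverse x)) has_real_derivative
        flat ([:0, 0, 1:] * (P - pderiv P)) x) (at x)"
      using 1 by (auto intro!: derivative_eq_intros DERIV_chain2[OF poly_DERIV]
          simp: flat_def algebra_simps power2_eq_square)
    then show ?thesis
      by (rule DERIV_cong_ev[THEN iffD1, OF refl _ refl, rotated])
        (use 1 in \<open>auto simp: flat_def eventually_nhds intro!: exI[of _ "{0<..}"]\<close>)
  next
    case 2
    have "((\<lambda>x. 0) has_real_derivative flat ([:0, 0, 1:] * (P - pderiv P)) x) (at x)"
      using 2 by (auto simp: flat_def)
    then show ?thesis
      by (rule DERIV_cong_ev[THEN iffD1, OF refl _ refl, rotated])
        (use 2 in \<open>auto simp: flat_def eventually_nhds intro!: exI[of _ "{..<0}"]\<close>)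
  next
    case 3
    have "((\<lambda>h. poly (pCons 0 P) (inverse h) * exp (- inverse h)) \<longlongrightarrow> 0) (at_right (0::real))"
      using filterlim_compose[OF poly_times_exp_tendsto_0 filterlim_inverse_at_top_right] .
    then have R: "((\<lambda>h. flat P h / h) \<longlongrightarrow> 0) (at_right 0)"
      by (rule Lim_transform_eventually)
        (auto simp: flat_def divide_inverse intro!: eventually_mono[OF eventually_at_right_less])
    have L: "((\<lambda>h. flat P h / h) \<longlongrightarrow> 0) (at_left 0)"
      by (rule Lim_transform_eventually[OF tendsto_const])
        (auto simp: flat_def eventually_at_filter)
    have "((\<lambda>h. flat P h / h) \<longlongrightarrow> 0) (at 0)"
      using L R by (rule filterlim_split_at)
    then show ?thesis
      using 3 by (simp add: DERIV_def flat_def)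
  qed
qed

lemma smooth_real_flat: "smooth_real (flat P)"
proof -
  have "times_differentiable n (flat P)" for n
  proof (induction n arbitrary: P)
    case (Suc n)
    have "deriv (flat P) = flat ([:0, 0, 1:] * (P - pderiv P))"
      by (intro ext DERIV_imp_deriv flat_has_derivative)
    with Suc show ?case
      using flat_has_derivative[of P] by (auto simp: field_differentiable_def)
  qed simp
  then show ?thesis by (simp add: smooth_real_def)
qed

lemma funpow_deriv_vanishes:
  fixes f :: "real \<Rightarrow> real"
  assumes "\<And>u. 1 < \<bar>u\<bar> \<Longrightarrow> f u = 0" and "1 < \<bar>u\<bar>"
  shows "(deriv ^^ i) f u = 0"
  using assms(2)
proof (induction i arbitrary: u)
  case (Suc i)
  have "open {v::real. 1 < \<bar>v\<bar>}"
    by (intro open_Collect_less continuous_intros)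
  then have "eventually (\<lambda>v. (deriv ^^ i) f v = 0) (nhds u)"
    using Suc unfolding eventually_nhds by (intro exI[of _ "{v. 1 < \<bar>v\<bar>}"]) auto
  then have "deriv ((deriv ^^ i) f) u = deriv (\<lambda>_. 0) u"
    by (intro deriv_cong_ev) auto
  then show ?case by simp
qed (use assms(1) in auto)

text \<open>A smooth bump: nonnegative, supported in \<open>[-1, 1]\<close>, and at least \<open>1\<close> on
  \<open>[-1/2, 1/2]\<close>. The factor \<open>exp 4\<close> compensates the two factors
  \<open>exp(-1/x) \<ge> exp(-2)\<close> for \<open>x \<ge> 1/2\<close>.\<close>

definition bump :: "real \<Rightarrow> real" where
  "bump u = exp 4 * flat 1 (u + 1) * flat 1 (- u + 1)"

lemma smooth_real_bump: "smooth_real bump"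
proof -
  have "smooth_real (\<lambda>u. exp 4 * flat 1 (1 * u + 1) * (1 * flat 1 ((-1) * u + 1)))"
    unfolding smooth_real_def
    using smooth_real_flat[unfolded smooth_real_def]
    by (intro allI times_differentiable_mult times_differentiable_affine) blast+
  then show ?thesis
    by (simp add: bump_def [abs_def])
qed

lemma bump_nonneg: "0 \<le> bump u"
  by (auto simp: bump_def flat_def)

lemma bump_vanishes: "1 < \<bar>u\<bar> \<Longrightarrow> bump u = 0"
  by (auto simp: bump_def flat_def)

lemma bump_ge_1:
  assumes "\<bar>u\<bar> \<le> 1/2"
  shows "1 \<le> bump u"
proof -
  have *: "exp (-2) \<le> flat 1 v" if "1/2 \<le> v" for v
  proof -
    have "inverse v \<le> inverse (1/2)" using that by (intro le_imp_inverse_le) auto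
    then show ?thesis using that by (simp add: flat_def)
  qed
  have "exp 4 * (exp (-2) * exp (-2)) \<le> exp 4 * (flat 1 (u + 1) * flat 1 (- u + 1))"
    using assms by (intro mult_left_mono mult_mono *) (auto simp: flat_def)
  then show ?thesis
    by (simp add: bump_def mult.assoc flip: exp_add)
qed

lemma bump_derivatives_bounded:
  obtains B where "\<And>i u. i \<le> N \<Longrightarrow> \<bar>(deriv ^^ i) bump u\<bar> \<le> B" "0 \<le> B"
proof -
  have "\<exists>b. \<forall>u. \<bar>(deriv ^^ i) bump u\<bar> \<le> b" for i
  proof -
    have "compact ((deriv ^^ i) bump ` {-1..1})"
      by (intro compact_continuous_image smooth_real_continuous smooth_real_funpow_deriv smooth_real_bump) auto
    then obtain b where b: "\<forall>u\<in>{-1..1}. \<bar>(deriv ^^ i) bump u\<bar> \<le> b"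
      by (auto dest!: compact_imp_bounded simp: bounded_iff)
    have "\<bar>(deriv ^^ i) bump u\<bar> \<le> \<bar>b\<bar>" for u
      using b[rule_format, of u] funpow_deriv_vanishes[where f = bump and u = u and i = i, OF bump_vanishes]
      by (cases "1 < \<bar>u\<bar>") (auto simp: not_less abs_le_iff intro: order_trans[OF _ abs_ge_self])
    then show ?thesis by blast
  qed
  then obtain b where b: "\<And>i u. \<bar>(deriv ^^ i) bump u\<bar> \<le> b i" by metis
  then have pos: "0 \<le> b i" for i
    by (meson abs_ge_zero order_trans)
  show thesis
  proof
    show "\<bar>(deriv ^^ i) bump u\<bar> \<le> (\<Sum>j\<le>N. b j)" if "i \<le> N" for i u
      using b[of i u] member_le_sum[of i "{..N}" b] pos that by fastforce
    show "0 \<le> (\<Sum>j\<le>N. b j)" using pos by (intro sum_nonneg)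
  qed
qed

section \<open>Sums of product bumps over a lattice\<close>

text \<open>The sum over \<open>(p, q) \<in> S\<close> of the product functions \<open>f(x\<^sub>1/r - p) g(x\<^sub>2/r - q)\<close>,
  which live near the lattice points \<open>(r p, r q)\<close> when \<open>f\<close> and \<open>g\<close> are supported in
  \<open>[-1, 1]\<close>, multiplied by \<open>c\<close>. Partial derivatives stay in this class: each one
  differentiates \<open>f\<close> or \<open>g\<close> and divides \<open>c\<close> by \<open>r\<close>.\<close>

definition tensor_sum ::
    "real \<Rightarrow> (int \<times> int) set \<Rightarrow> real \<Rightarrow> (real \<Rightarrow> real) \<Rightarrow> (real \<Rightarrow> real) \<Rightarrow> real^2 \<Rightarrow> real" where
  "tensor_sum r S c f g x = c * (\<Sum>(p, q)\<in>S. f (x $ 1 / r - p) * g (x $ 2 / r - q))"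

lemma partial_deriv_tensor_sum_1:
  assumes "smooth_real f"
  shows "partial_deriv 1 (tensor_sum r S c f g) = tensor_sum r S (c / r) (deriv f) g"
proof
  fix x :: "real^2"
  have *: "((\<lambda>t. f ((x $ 1 + t) / r - p)) has_real_derivative deriv f (x $ 1 / r - p) * (1 / r)) (at 0)" for p
  proof -
    have "(f has_real_derivative deriv f ((x $ 1 + 0) / r - p)) (at ((x $ 1 + 0) / r - p))"
      using assms by (rule smooth_real_has_derivative)
    then have "((\<lambda>t. f ((x $ 1 + t) / r - p)) has_real_derivative deriv f ((x $ 1 + 0) / r - p) * (1 / r)) (at 0)"
      by (rule DERIV_chain2[where f = f]) (auto intro!: derivative_eq_intros simp: divide_inverse)
    then show ?thesis by simp
  qed
  have "((\<lambda>t. c * (\<Sum>(p, q)\<in>S. f ((x $ 1 + t) / r - p) * g (x $ 2 / r - q))) has_real_derivative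
      c * (\<Sum>(p, q)\<in>S. (deriv f (x $ 1 / r - p) * (1 / r)) * g (x $ 2 / r - q))) (at 0)"
    unfolding case_prod_beta by (intro DERIV_cmult DERIV_sum DERIV_cmult_right *)
  from DERIV_imp_deriv[OF this]
  show "partial_deriv 1 (tensor_sum r S c f g) x = tensor_sum r S (c / r) (deriv f) g x"
    unfolding partial_deriv_def tensor_sum_def
    by (simp add: axis_def sum_distrib_left case_prod_beta mult_ac)
qed

lemma partial_deriv_tensor_sum_2:
  assumes "smooth_real g"
  shows "partial_deriv 2 (tensor_sum r S c f g) = tensor_sum r S (c / r) f (deriv g)"
proof
  fix x :: "real^2"
  have *: "((\<lambda>t. g ((x $ 2 + t) / r - q)) has_real_derivative deriv g (x $ 2 / r - q) * (1 / r)) (at 0)" for q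
  proof -
    have "(g has_real_derivative deriv g ((x $ 2 + 0) / r - q)) (at ((x $ 2 + 0) / r - q))"
      using assms by (rule smooth_real_has_derivative)
    then have "((\<lambda>t. g ((x $ 2 + t) / r - q)) has_real_derivative deriv g ((x $ 2 + 0) / r - q) * (1 / r)) (at 0)"
      by (rule DERIV_chain2[where f = g]) (auto intro!: derivative_eq_intros simp: divide_inverse)
    then show ?thesis by simp
  qed
  have "((\<lambda>t. c * (\<Sum>(p, q)\<in>S. f (x $ 1 / r - p) * g ((x $ 2 + t) / r - q))) has_real_derivative
      c * (\<Sum>(p, q)\<in>S. f (x $ 1 / r - p) * (deriv g (x $ 2 / r - q) * (1 / r)))) (at 0)"
    unfolding case_prod_beta by (intro DERIV_cmult DERIV_sum *)
  from DERIV_imp_deriv[OF this]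
  show "partial_deriv 2 (tensor_sum r S c f g) x = tensor_sum r S (c / r) f (deriv g) x"
    unfolding partial_deriv_def tensor_sum_def
    by (simp add: axis_def sum_distrib_left case_prod_beta mult_ac)
qed

lemma partial_derivs_tensor_sum:
  assumes "smooth_real f" "smooth_real g"
  shows "(partial_deriv 1 ^^ i) ((partial_deriv 2 ^^ j) (tensor_sum r S c f g)) =
    tensor_sum r S (c / r ^ (i + j)) ((deriv ^^ i) f) ((deriv ^^ j) g)"
proof -
  have 2: "(partial_deriv 2 ^^ j) (tensor_sum r S c f g) = tensor_sum r S (c / r ^ j) f ((deriv ^^ j) g)"
    by (induction j) (simp_all add: partial_deriv_tensor_sum_2 smooth_real_funpow_deriv assms mult.commute)
  have "(partial_deriv 1 ^^ i) (tensor_sum r S c f g) = tensor_sum r S (c / r ^ i) ((deriv ^^ i) f) g" for c g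
    by (induction i) (simp_all add: partial_deriv_tensor_sum_1 smooth_real_funpow_deriv assms mult.commute)
  then show ?thesis
    unfolding 2 by (simp add: power_add mult.commute)
qed

lemma tensor_sum_differentiable:
  assumes "smooth_real f" "smooth_real g"
  shows "tensor_sum r S c f g differentiable_on UNIV"
proof -
  have F: "(\<lambda>x::real^2. f (x $ 1 * inverse r - p)) differentiable (at x)" for p x
  proof -
    have "f differentiable (at (x $ 1 * inverse r - p))"
      using assms(1) smooth_real_has_derivative real_differentiable_def by blast
    then show ?thesis
      by (rule differentiable_compose[where f = f])
        (intro derivative_intros bounded_linear_imp_differentiable bounded_linear_vec_nth)
  qed
  have G: "(\<lambda>x::real^2. g (x $ 2 * inverse r - p)) differentiable (at x)" for p x
  proof -
    have "g differentiable (at (x $ 2 * inverse r - p))"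
      using assms(2) smooth_real_has_derivative real_differentiable_def by blast
    then show ?thesis
      by (rule differentiable_compose[where f = g])
        (intro derivative_intros bounded_linear_imp_differentiable bounded_linear_vec_nth)
  qed
  show ?thesis
  proof (cases "finite S")
    case True
    then have "(\<lambda>x. c * (\<Sum>s\<in>S. f (x $ 1 / r - fst s) * g (x $ 2 / r - snd s))) differentiable (at x)" for x :: "real^2"
      by (intro differentiable_mult differentiable_sum F[folded divide_inverse] G[folded divide_inverse] ballI) auto
    then show ?thesis
      by (simp add: tensor_sum_def[abs_def] case_prod_beta differentiable_on_def)
  qed (simp add: tensor_sum_def[abs_def])
qed

lemma C_diff_tensor_sum:
  "smooth_real f \<Longrightarrow> smooth_real g \<Longrightarrow> C_diff n (tensor_sum r S c f g)"
proof (induction n arbitrary: c f g)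
  case 0
  then show ?case
    by (simp add: tensor_sum_differentiable differentiable_imp_continuous_on)
next
  case (Suc n)
  have "C_diff n (partial_deriv i (tensor_sum r S c f g))" for i
    using exhaust_2[of i] Suc
    by (auto simp: partial_deriv_tensor_sum_1 partial_deriv_tensor_sum_2 smooth_real_deriv)
  with Suc.prems show ?case by (simp add: tensor_sum_differentiable)
qed

text \<open>The bound does not depend on the number of lattice points, since at most
  \<open>9\<close> of the summands are nonzero at any given point.\<close>

lemma tensor_sum_bound:
  assumes "\<And>u. \<bar>f u\<bar> \<le> B" "\<And>u. \<bar>g u\<bar> \<le> B"
    and "\<And>u. 1 < \<bar>u\<bar> \<Longrightarrow> f u = 0" "\<And>u. 1 < \<bar>u\<bar> \<Longrightarrow> g u = 0" and "finite S"
  shows "\<bar>tensor_sum r S c f g x\<bar> \<le> \<bar>c\<bar> * (9 * B\<^sup>2)"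
proof -
  define I where "I u = {\<lfloor>u\<rfloor> - 1..\<lfloor>u\<rfloor> + 1}" for u :: real
  define T where "T = I (x $ 1 / r) \<times> I (x $ 2 / r)"
  define h where "h = (\<lambda>(p, q). f (x $ 1 / r - real_of_int p) * g (x $ 2 / r - real_of_int q))"
  have I: "1 < \<bar>u - of_int p\<bar>" if "p \<notin> I u" for u :: real and p
    using that unfolding I_def by auto linarith+
  have B: "0 \<le> B" using assms(1)[of 0] by linarith
  have "\<bar>\<Sum>s\<in>S. h s\<bar> \<le> (\<Sum>s\<in>S. \<bar>h s\<bar>)" by (rule sum_abs)
  also have "\<dots> = (\<Sum>s\<in>S \<inter> T. \<bar>h s\<bar>)"
  proof (intro sum.mono_neutral_right ballI)
    fix s assume "s \<in> S - S \<inter> T"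
    then have "fst s \<notin> I (x $ 1 / r) \<or> snd s \<notin> I (x $ 2 / r)"
      by (auto simp: T_def mem_Times_iff)
    then show "\<bar>h s\<bar> = 0"
      using I assms(3,4) by (auto simp: h_def case_prod_beta)
  qed (use \<open>finite S\<close> in auto)
  also have "\<dots> \<le> (\<Sum>s\<in>T. \<bar>h s\<bar>)"
    by (intro sum_mono2) (auto simp: T_def I_def)
  also have "\<dots> \<le> (\<Sum>s\<in>T. B\<^sup>2)"
    using assms B by (intro sum_mono) (auto simp: h_def abs_mult power2_eq_square intro!: mult_mono)
  also have "\<dots> = 9 * B\<^sup>2"
    by (simp add: T_def I_def card_cartesian_product)
  finally show ?thesis
    by (simp add: tensor_sum_def h_def abs_mult mult_left_mono)
qed

text \<open>For \<open>r > 0\<close>, the pairs \<open>(p, q)\<close> for which the closed square of side \<open>r\<close> centred at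
  the lattice point \<open>(r p, r q)\<close> meets \<open>X\<close>.\<close>

definition cells_meeting :: "real \<Rightarrow> (real^2) set \<Rightarrow> (int \<times> int) set" where
  "cells_meeting r X =
     {(p, q). \<exists>y\<in>X. \<bar>y $ 1 / r - p\<bar> \<le> 1/2 \<and> \<bar>y $ 2 / r - q\<bar> \<le> 1/2}"

lemma finite_cells_meeting:
  assumes "bounded X"
  shows "finite (cells_meeting r X)"
proof -
  obtain b where b: "\<And>y. y \<in> X \<Longrightarrow> norm y \<le> b"
    using assms by (auto simp: bounded_iff)
  define m where "m = \<lceil>b / \<bar>r\<bar> + 1\<rceil>"
  have *: "p \<in> {-m..m}" if "\<bar>v / r - real_of_int p\<bar> \<le> 1/2" "\<bar>v\<bar> \<le> b" for v p
  proof -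
    have "\<bar>v / r\<bar> \<le> b / \<bar>r\<bar>" using that(2) by (simp add: abs_divide divide_right_mono)
    then have "\<bar>real_of_int p\<bar> \<le> b / \<bar>r\<bar> + 1" using that(1) by linarith
    then have "\<bar>p\<bar> \<le> m" unfolding m_def by linarith
    then show ?thesis by auto
  qed
  have "cells_meeting r X \<subseteq> {-m..m} \<times> {-m..m}"
  proof
    fix s assume "s \<in> cells_meeting r X"
    then obtain p q y where s: "s = (p, q)" "y \<in> X" "\<bar>y $ 1 / r - p\<bar> \<le> 1/2" "\<bar>y $ 2 / r - q\<bar> \<le> 1/2"
      by (auto simp: cells_meeting_def)
    have "\<bar>y $ i\<bar> \<le> b" for i
      using component_le_norm_cart[of y i] b[OF s(2)] by linarith
    with s * show "s \<in> {-m..m} \<times> {-m..m}" by blast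
  qed
  then show ?thesis by (rule finite_subset) auto
qed

text \<open>A bump that is nonzero at \<open>x\<close> sits within \<open>r\<close> of \<open>x\<close> and within \<open>r/2\<close> of
  some point of \<open>X\<close>, in each coordinate.\<close>

lemma tensor_sum_cells_nonzero:
  assumes "tensor_sum r (cells_meeting r X) c f g x \<noteq> 0" and "0 < r"
    and "\<And>u. 1 < \<bar>u\<bar> \<Longrightarrow> f u = 0" "\<And>u. 1 < \<bar>u\<bar> \<Longrightarrow> g u = 0"
  obtains y where "y \<in> X" "dist x y \<le> 3 * r"
proof -
  obtain p q where s: "(p, q) \<in> cells_meeting r X" "f (x $ 1 / r - p) \<noteq> 0" "g (x $ 2 / r - q) \<noteq> 0"
    using assms(1) unfolding tensor_sum_def
    by (metis (mono_tags, lifting) case_prodE2 mult_eq_0_iff sum.neutral case_prod_beta prod.collapse)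
  then obtain y where y: "y \<in> X" "\<bar>y $ 1 / r - p\<bar> \<le> 1/2" "\<bar>y $ 2 / r - q\<bar> \<le> 1/2"
    by (auto simp: cells_meeting_def)
  have "\<bar>x $ 1 / r - p\<bar> \<le> 1" "\<bar>x $ 2 / r - q\<bar> \<le> 1"
    using s assms(3,4) by (metis not_less)+
  then have "\<bar>x $ 1 / r - y $ 1 / r\<bar> \<le> 3/2" "\<bar>x $ 2 / r - y $ 2 / r\<bar> \<le> 3/2"
    using y by linarith+
  then have "\<bar>x $ 1 - y $ 1\<bar> \<le> 3/2 * r" "\<bar>x $ 2 - y $ 2\<bar> \<le> 3/2 * r"
    using assms(2) by (simp_all add: abs_divide pos_divide_le_eq flip: diff_divide_distrib)
  then have "dist x y \<le> 3 * r"
    using norm_le_l1_cart[of "x - y"] by (simp add: dist_norm sum_2)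
  with y show thesis using that by blast
qed

section \<open>Porosity on lines and measure\<close>

lemma fmeasurable_Int_Icc:
  fixes E :: "real set"
  assumes "E \<in> sets borel"
  shows "E \<inter> {b..c} \<in> fmeasurable lborel"
proof (rule fmeasurableI2)
  show "{b..c} \<in> fmeasurable lborel"
    by (auto simp: fmeasurable_def emeasure_lborel_Icc_eq)
qed (use assms in auto)

text \<open>If, of the \<open>M\<close> equal pieces of any interval of length in \<open>[\<l>, \<Lambda>]\<close>, at least one
  misses \<open>E\<close>, then each subdivision step gains a factor \<open>(M - 1)/M\<close> in the measure of
  \<open>E\<close>. The subdivision can be repeated \<open>n\<close> times as long as the intervals that are
  divided in the last step still have length \<open>L/M\<^sup>n\<^sup>-\<^sup>1 \<ge> \<l>\<close>.\<close>

lemma measure_le_of_gaps: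
  fixes E :: "real set" and M :: nat and L \<Lambda> \<l> :: real
  assumes E: "E \<in> sets borel" and M: "0 < M" and l: "0 \<le> \<l>"
    and gap: "\<And>a L. \<l> \<le> L \<Longrightarrow> 0 < L \<Longrightarrow> L \<le> \<Lambda> \<Longrightarrow>
      \<exists>i<M. E \<inter> {a + real i * (L / M) .. a + real i * (L / M) + L / M} = {}"
  shows "0 < L \<Longrightarrow> L \<le> \<Lambda> \<Longrightarrow> \<l> * real M ^ n \<le> L * M \<Longrightarrow>
    measure lborel (E \<inter> {a..a + L}) \<le> ((real M - 1) / M) ^ n * L"
proof (induction n arbitrary: a L)
  case 0
  have "measure lborel (E \<inter> {a..a + L}) \<le> measure lborel {a..a + L}"
    using E by (intro measure_mono_fmeasurable) (auto simp: fmeasurable_def emeasure_lborel_Icc_eq)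
  also have "\<dots> = L" using 0 by simp
  finally show ?case by simp
next
  case (Suc n)
  define P where "P i = E \<inter> {a + real i * (L / M) .. a + real i * (L / M) + L / M}" for i
  have LM: "0 < L / M" "L / M \<le> \<Lambda>" "\<l> * real M ^ n \<le> L / M * M"
  proof -
    have "L * 1 \<le> \<Lambda> * real M" using Suc.prems M by (intro mult_mono) auto
    then show "0 < L / M" "L / M \<le> \<Lambda>" "\<l> * real M ^ n \<le> L / M * M"
      using Suc.prems M by (auto simp: divide_le_eq)
  qed
  have "\<l> * 1 \<le> \<l> * real M ^ n"
    using l M by (intro mult_left_mono one_le_power) auto
  then have "\<l> \<le> L" using LM(3) M by simp
  then obtain i where i: "i < M" "P i = {}"
    using gap Suc.prems unfolding P_def by blast
  have cover: "E \<inter> {a..a + L} \<subseteq> (\<Union>j\<in>{..<M} - {i}. P j)"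
  proof
    fix t assume t: "t \<in> E \<inter> {a..a + L}"
    define u where "u = (t - a) / (L / M)"
    \<comment> \<open>capped at \<open>M - 1\<close> because \<open>t\<close> may be the right endpoint\<close>
    define j where "j = min (nat \<lfloor>u\<rfloor>) (M - 1)"
    have "t - a \<le> M * (L / M)" using t M by simp
    then have u: "0 \<le> u" "u \<le> M"
      using t LM(1) Suc.prems M unfolding u_def pos_divide_le_eq[OF LM(1)]
      by (simp_all add: zero_le_divide_iff)
    have "u * (L / M) = t - a"
      using LM(1) M Suc.prems(1) unfolding u_def by (subst nonzero_eq_divide_eq[symmetric]) simp_all
    then have "t = a + u * (L / M)" by simp
    moreover have "real j \<le> u" "u \<le> real j + 1"
      using u M unfolding j_def by (auto simp: min_def of_nat_diff) linarith+
    then have "real j * (L / M) \<le> u * (L / M)" "u * (L / M) \<le> (real j + 1) * (L / M)"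
      using LM(1) by (intro mult_right_mono; simp)+
    ultimately have tP: "t \<in> P j"
      using t unfolding P_def distrib_right by simp
    have "j < M" using M by (simp add: j_def min_less_iff_disj)
    moreover have "j \<noteq> i" using tP i by auto
    ultimately show "t \<in> (\<Union>j\<in>{..<M} - {i}. P j)"
      using tP by blast
  qed
  have meas: "P j \<in> fmeasurable lborel" for j
    using E unfolding P_def
    by (rule fmeasurable_Int_Icc)
  have "measure lborel (E \<inter> {a..a + L}) \<le> measure lborel (\<Union>j\<in>{..<M} - {i}. P j)"
    using cover E meas by (intro measure_mono_fmeasurable fmeasurable.finite_UN) auto
  also have "\<dots> \<le> (\<Sum>j\<in>{..<M} - {i}. measure lborel (P j))"
    using meas[THEN fmeasurableD] by (intro measure_UNION_le) auto
  also have "\<dots> \<le> (\<Sum>j\<in>{..<M} - {i}. ((real M - 1) / M) ^ n * (L / M))"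
    using Suc.IH[OF LM] by (intro sum_mono) (simp add: P_def)
  also have "\<dots> = ((real M - 1) / M) ^ Suc n * L"
    using i M by (simp add: of_nat_diff)
  finally show ?case .
qed

text \<open>Porosity of \<open>Y\<close> gives the gaps in the set \<open>E\<close> of parameters at which a line comes
  \<open>d\<close>-close to \<open>Y\<close>: the hole of radius \<open>\<nu> L\<close> shrinks to one of radius at least
  \<open>\<nu> L/2\<close>, and this is longer than one of the \<open>M\<close> pieces. So the piece that contains the
  centre of the hole misses \<open>E\<close>.\<close>

lemma porous_on_lines_gap:
  fixes Y :: "'a::euclidean_space set" and M :: nat
  assumes por: "porous_on_lines \<nu> Y 1 \<Lambda>" and L: "1 \<le> L" "L \<le> \<Lambda>"
    and e: "norm e = 1" and E: "\<And>t. t \<in> E \<Longrightarrow> \<exists>y\<in>Y. dist (t *\<^sub>R e) y \<le> d"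
    and d: "2 * d \<le> \<nu> * L" and M: "2 < \<nu> * M" "0 < M"
  shows "\<exists>i<M. E \<inter> {a + real i * (L / M) .. a + real i * (L / M) + L / M} = {}"
proof -
  have "dist (a *\<^sub>R e) ((a + L) *\<^sub>R e) = L"
    using L e by (simp add: dist_norm flip: scaleR_diff_left)
  then obtain x where x: "x \<in> closed_segment (a *\<^sub>R e) ((a + L) *\<^sub>R e)" "Y \<inter> ball x (\<nu> * L) = {}"
    using por L unfolding porous_on_lines_def by metis
  then obtain u where u: "0 \<le> u" "u \<le> 1" "x = (1 - u) *\<^sub>R a *\<^sub>R e + u *\<^sub>R (a + L) *\<^sub>R e"
    by (auto simp: closed_segment_def)
  define s where "s = a + u * L"
  have xs: "x = s *\<^sub>R e"
    unfolding u(3) s_def by (simp add: algebra_simps)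
  have far: "\<nu> * L / 2 \<le> \<bar>t - s\<bar>" if "t \<in> E" for t
  proof -
    obtain y where y: "y \<in> Y" "dist (t *\<^sub>R e) y \<le> d" using E \<open>t \<in> E\<close> by blast
    have "\<nu> * L \<le> dist x y" using x(2) y(1) by (auto simp: disjoint_iff not_less)
    also have "\<dots> \<le> dist x (t *\<^sub>R e) + dist (t *\<^sub>R e) y" by (rule dist_triangle)
    also have "dist x (t *\<^sub>R e) = \<bar>t - s\<bar>"
      using e unfolding xs by (simp add: dist_norm abs_minus_commute flip: scaleR_diff_left)
    finally show ?thesis using y(2) d by linarith
  qed
  \<comment> \<open>the piece that contains \<open>s\<close>; capped at \<open>M - 1\<close> because \<open>s\<close> may be the right endpoint\<close>
  define i where "i = min (nat \<lfloor>u * M\<rfloor>) (M - 1)"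
  have uM: "0 \<le> u * M" "u * M \<le> M" using u by (auto simp: mult_left_le_one_le)
  have i: "real i \<le> u * M" "u * M \<le> real i + 1" "i < M"
    using uM M unfolding i_def by (auto simp: min_def of_nat_diff) linarith+
  have LM: "0 < L / M" "L / M < \<nu> * L / 2"
    using L M by (auto simp: pos_divide_less_eq)
  have s: "s = a + (u * M) * (L / M)" using M by (simp add: s_def)
  have "t \<notin> E" if t: "t \<in> {a + real i * (L / M) .. a + real i * (L / M) + L / M}" for t
  proof
    assume "t \<in> E"
    have "real i * (L / M) \<le> (u * M) * (L / M)" "(u * M) * (L / M) \<le> (real i + 1) * (L / M)"
      using i LM by (intro mult_right_mono; simp)+
    moreover have "(real i + 1) * (L / M) = real i * (L / M) + L / M"
      unfolding distrib_right by simp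
    ultimately have "\<bar>t - s\<bar> \<le> L / M" using t unfolding s by auto
    with far[OF \<open>t \<in> E\<close>] LM show False by linarith
  qed
  with i show ?thesis by blast
qed

lemma measure_chain_le:
  fixes E :: "real set"
  assumes "E \<in> sets borel" and "\<And>a. measure lborel (E \<inter> {a..a + L}) \<le> m" and "0 \<le> L"
  shows "measure lborel (E \<inter> {a..a + real N * L}) \<le> N * m"
proof (induction N)
  case 0
  have "measure lborel (E \<inter> {a..a}) \<le> measure lborel {a..a}"
    using assms by (intro measure_mono_fmeasurable) (auto simp: fmeasurable_def emeasure_lborel_Icc_eq)
  then show ?case by simp
next
  case (Suc N)
  have f: "E \<inter> {b..c} \<in> fmeasurable lborel" for b c
    using assms(1) by (rule fmeasurable_Int_Icc)
  have "measure lborel (E \<inter> {a..a + real (Suc N) * L}) \<le>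
      measure lborel ((E \<inter> {a..a + real N * L}) \<union> (E \<inter> {a + real N * L..a + real N * L + L}))"
    using f by (intro measure_mono_fmeasurable fmeasurable.Un) (auto simp: algebra_simps assms(1))
  also have "\<dots> \<le> measure lborel (E \<inter> {a..a + real N * L}) + measure lborel (E \<inter> {a + real N * L..a + real N * L + L})"
    using f[THEN fmeasurableD] by (intro measure_Un_le)
  also have "\<dots> \<le> N * m + m"
    using Suc assms(2) by (intro add_mono)
  finally show ?case by (simp add: algebra_simps)
qed

section \<open>The weight at one scale\<close>

text \<open>On the annulus \<open>K/2 \<le> norm x\<close> the factor \<open>1/(norm x)\<^sup>2\<close> is at most
  \<open>4/K\<^sup>2\<close>, so a weight bounded by \<open>a\<close> contributes at most \<open>4 a/K\<^sup>2\<close> times the length of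
  the part of a line through the origin on which it is nonzero.\<close>

lemma xray_growth_le:
  fixes w :: "real^2 \<Rightarrow> real"
  assumes cont: "continuous_on UNIV w" and K: "0 < K" and a: "\<And>x. - a \<le> w x" "0 \<le> a"
    and ann: "\<And>x. w x \<noteq> 0 \<Longrightarrow> K / 2 \<le> norm x \<and> norm x \<le> 2 * K"
    and m: "\<And>\<theta>. measure lborel ({t. w (vector [t * cos \<theta>, t * sin \<theta>]) \<noteq> 0} \<inter> {- 2 * K..2 * K}) \<le> m"
  shows "xray_growth w \<le> 4 * a / K\<^sup>2 * m"
proof -
  have "- (4 * a / K\<^sup>2 * m) \<le> xray (\<lambda>x. w x / (norm x)\<^sup>2) 0 \<theta>" for \<theta>
  proof -
    define v :: "real \<Rightarrow> real^2" where "v t = vector [t * cos \<theta>, t * sin \<theta>]" for t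
    define E where "E = {t. w (v t) \<noteq> 0} \<inter> {- 2 * K..2 * K}"
    have v: "v t = t *\<^sub>R vector [cos \<theta>, sin \<theta>]" for t
      by (simp add: v_def vec_eq_iff forall_2)
    have nv: "norm (v t) = \<bar>t\<bar>" for t
    proof -
      have "(t * cos \<theta>)\<^sup>2 + (t * sin \<theta>)\<^sup>2 = t\<^sup>2"
        by (simp add: power_mult_distrib flip: distrib_left)
      then show ?thesis by (simp add: norm_vec_def L2_set_def sum_2 v_def)
    qed
    have "continuous_on UNIV (\<lambda>t. w (v t))"
      unfolding v by (intro continuous_on_compose2[OF cont] continuous_intros) auto
    then have "open {t. w (v t) \<noteq> 0}"
      by (intro open_Collect_neq) auto
    then have Em: "E \<in> fmeasurable lborel"
      unfolding E_def by (intro fmeasurable_Int_Icc borel_open)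
    have pt: "- (w (v t) / (norm (v t))\<^sup>2) \<le> 4 * a / K\<^sup>2 * indicator E t" for t
    proof (cases "w (v t) = 0")
      case True
      then show ?thesis using a by simp
    next
      case False
      then have t: "K / 2 \<le> \<bar>t\<bar>" "\<bar>t\<bar> \<le> 2 * K" using ann nv by metis+
      then have "t \<in> E" using False by (auto simp: E_def)
      have "(K / 2)\<^sup>2 \<le> \<bar>t\<bar>\<^sup>2" using t K by (intro power_mono) auto
      then have "- w (v t) / t\<^sup>2 \<le> a / (K / 2)\<^sup>2"
        using a(1)[of "v t"] a(2) K by (intro frac_le) auto
      then show ?thesis using \<open>t \<in> E\<close> by (simp add: nv power_divide mult.commute)
    qed
    have "xray (\<lambda>x. w x / (norm x)\<^sup>2) 0 \<theta> = - (LINT t|lborel. - (w (v t) / (norm (v t))\<^sup>2))"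
      by (simp add: xray_def v_def)
    moreover have "(LINT t|lborel. - (w (v t) / (norm (v t))\<^sup>2)) \<le> (LINT t|lborel. 4 * a / K\<^sup>2 * indicator E t)"
      using Em a by (intro integral_mono' pt) (auto simp: fmeasurable_def)
    moreover have "\<dots> = 4 * a / K\<^sup>2 * measure lborel E" by simp
    moreover have "\<dots> \<le> 4 * a / K\<^sup>2 * m"
      using m[of \<theta>] a by (intro mult_left_mono) (auto simp: E_def v_def)
    ultimately show ?thesis by linarith
  qed
  then have "- (4 * a / K\<^sup>2 * m) \<le> (INF \<theta>\<in>{0..<2*pi}. xray (\<lambda>x. w x / (norm x)\<^sup>2) 0 \<theta>)"
    by (intro cINF_greatest) auto
  then show ?thesis by (simp add: xray_growth_def)
qed

text \<open>The annuli \<open>core (2\<^sup>k)\<close> with \<open>k \<ge> 0\<close> cover the set \<open>norm x \<ge> 3/4\<close>, and for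
  \<open>K > 0\<close> the distance of \<open>core K\<close> from the complement of the annulus
  \<open>K/2 \<le> norm x \<le> 2 K\<close> is \<open>K/4\<close>. This leaves room for bumps of width comparable to \<open>K\<close>.\<close>

definition core :: "real \<Rightarrow> (real^2) set" where
  "core K = {y. 3/4 * K \<le> norm y \<and> norm y \<le> 3/2 * K}"

text \<open>The weight at scale \<open>K\<close>: \<open>-A\<close> times a sum of bumps that is at least \<open>1\<close> on the part
  of \<open>Y\<close> in \<open>core K\<close> and vanishes at distances greater than \<open>3 r\<close> from it.\<close>

definition weight :: "real \<Rightarrow> real \<Rightarrow> real \<Rightarrow> (real^2) set \<Rightarrow> real^2 \<Rightarrow> real" where
  "weight K r A Y = tensor_sum r (cells_meeting r (Y \<inter> core K)) (- A) bump bump"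

lemma finite_cells_core: "finite (cells_meeting r (Y \<inter> core K))"
proof (rule finite_cells_meeting)
  have "Y \<inter> core K \<subseteq> cball 0 (3/2 * K)" by (auto simp: core_def)
  then show "bounded (Y \<inter> core K)" by (rule bounded_subset[OF bounded_cball])
qed

lemma tensor_sum_core_nonzero:
  assumes "tensor_sum r (cells_meeting r (Y \<inter> core K)) c f g x \<noteq> 0" and "0 < r" "16 * r \<le> K"
    and "\<And>u. 1 < \<bar>u\<bar> \<Longrightarrow> f u = 0" "\<And>u. 1 < \<bar>u\<bar> \<Longrightarrow> g u = 0"
  shows "K / 2 \<le> norm x" "norm x \<le> 2 * K"
proof -
  obtain y where y: "y \<in> Y \<inter> core K" "dist x y \<le> 3 * r"
    using tensor_sum_cells_nonzero[OF assms(1,2,4,5)] by blast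
  have "\<bar>norm x - norm y\<bar> \<le> 3 * r"
    using y(2) norm_triangle_ineq3[of x y] by (simp add: dist_norm)
  then show "K / 2 \<le> norm x" "norm x \<le> 2 * K"
    using y(1) assms(2,3) by (auto simp: core_def)
qed

lemma weight_nonpos: "0 \<le> A \<Longrightarrow> weight K r A Y x \<le> 0"
  by (auto simp: weight_def tensor_sum_def bump_nonneg intro!: mult_nonneg_nonneg sum_nonneg)

lemma weight_le:
  assumes "0 \<le> A" "y \<in> Y" "y \<in> core K"
  shows "weight K r A Y y \<le> - A"
proof -
  define p q where "p = \<lfloor>y $ 1 / r + 1/2\<rfloor>" and "q = \<lfloor>y $ 2 / r + 1/2\<rfloor>"
  have pq: "\<bar>y $ 1 / r - p\<bar> \<le> 1/2" "\<bar>y $ 2 / r - q\<bar> \<le> 1/2"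
    unfolding p_def q_def by linarith+
  then have S: "(p, q) \<in> cells_meeting r (Y \<inter> core K)"
    using assms by (auto simp: cells_meeting_def)
  define h where "h = (\<lambda>(p, q). bump (y $ 1 / r - real_of_int p) * bump (y $ 2 / r - real_of_int q))"
  have "1 * 1 \<le> h (p, q)"
    unfolding h_def prod.case using pq by (intro mult_mono bump_ge_1) (auto simp: bump_nonneg)
  also have "\<dots> \<le> sum h (cells_meeting r (Y \<inter> core K))"
    using S finite_cells_core
    by (intro member_le_sum) (auto simp: h_def bump_nonneg case_prod_beta)
  finally have "A * 1 \<le> A * sum h (cells_meeting r (Y \<inter> core K))"
    using assms(1) by (intro mult_left_mono) auto
  then show ?thesis by (simp add: weight_def tensor_sum_def h_def)
qed

lemma weight_eq_0: "Y \<inter> core K = {} \<Longrightarrow> weight K r A Y x = 0"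
  by (simp add: weight_def tensor_sum_def cells_meeting_def)

lemma weight_supp:
  assumes "0 < r" "16 * r \<le> K"
  shows "supp (weight K r A Y) \<subseteq> {x. K / 2 \<le> norm x \<and> norm x \<le> 2 * K}"
  unfolding supp_def
proof (rule closure_minimal)
  show "support_on UNIV (weight K r A Y) \<subseteq> {x. K / 2 \<le> norm x \<and> norm x \<le> 2 * K}"
    using tensor_sum_core_nonzero[where f = bump and g = bump, OF _ assms bump_vanishes bump_vanishes]
    by (auto simp: support_on_def weight_def)
  show "closed {x::real^2. K / 2 \<le> norm x \<and> norm x \<le> 2 * K}"
    by (intro closed_Collect_conj closed_Collect_le continuous_intros)
qed

lemma weight_Cc_infinity:
  assumes "0 < r" "16 * r \<le> K"
  shows "weight K r A Y \<in> Cc_infinity"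
proof -
  have "bounded (supp (weight K r A Y))"
    using weight_supp[OF assms] by (auto simp: bounded_iff)
  then show ?thesis
    by (auto simp: Cc_infinity_def compact_eq_bounded_closed supp_def weight_def
        intro!: C_diff_tensor_sum smooth_real_bump)
qed

text \<open>A derivative of order \<open>n\<close> costs \<open>r\<^sup>-\<^sup>n\<close>, and the Japanese bracket is comparable to
  \<open>K\<close> where the weight lives, so the norm is bounded as soon as
  \<open>A r\<^sup>-\<^sup>n\<close> is at most a multiple of \<open>K\<^sup>1\<^sup>-\<^sup>n\<close> for \<open>n \<le> 3\<close>.\<close>

lemma weight_S13_norm_le:
  assumes B: "\<And>i u. i \<le> 3 \<Longrightarrow> \<bar>(deriv ^^ i) bump u\<bar> \<le> B"
    and K: "1 \<le> K" and r: "0 < r" "16 * r \<le> K" and "0 \<le> A" and D: "0 \<le> D"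
    and A: "\<And>n. n \<le> 3 \<Longrightarrow> A / r ^ n \<le> D * K / K ^ n"
  shows "S13_norm (weight K r A Y) \<le> 1152 * D * B\<^sup>2"
proof -
  have "\<bar>japanese_bracket x powi (int (i + j) - 1) *
      (partial_deriv 1 ^^ i) ((partial_deriv 2 ^^ j) (weight K r A Y)) x\<bar> \<le> 1152 * D * B\<^sup>2"
    if ij: "i + j \<le> 3" for i j x
  proof -
    define n where "n = i + j"
    define S where "S = cells_meeting r (Y \<inter> core K)"
    define F where "F = tensor_sum r S (- A / r ^ n) ((deriv ^^ i) bump) ((deriv ^^ j) bump) x"
    have F: "(partial_deriv 1 ^^ i) ((partial_deriv 2 ^^ j) (weight K r A Y)) x = F"
      by (simp add: weight_def partial_derivs_tensor_sum smooth_real_bump F_def S_def n_def)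
    have van: "(deriv ^^ l) bump u = 0" if "1 < \<bar>u\<bar>" for l u
      by (rule funpow_deriv_vanishes[OF bump_vanishes that])
    have n: "n \<le> 3" using ij by (simp add: n_def)
    show ?thesis
    proof (cases "F = 0")
      case True
      then show ?thesis using F D by simp
    next
      case False
      then have x: "K / 2 \<le> norm x" "norm x \<le> 2 * K"
        unfolding F_def S_def
        by - (rule tensor_sum_core_nonzero[OF _ r van van]; assumption)+
      define J where "J = japanese_bracket x"
      have "norm x \<le> J" unfolding J_def japanese_bracket_def
        by (rule real_le_rsqrt) simp
      then have J1: "K / 2 \<le> J" using x by linarith
      have "(norm x)\<^sup>2 \<le> (2 * K)\<^sup>2" using x by (intro power_mono) auto
      moreover have "1\<^sup>2 \<le> K\<^sup>2" using K by (intro power_mono) auto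
      ultimately have "1 + (norm x)\<^sup>2 \<le> (4 * K)\<^sup>2" by (simp add: power_mult_distrib)
      then have J2: "J \<le> 4 * K" unfolding J_def japanese_bracket_def
        using K by (intro real_le_lsqrt) auto
      have J0: "0 < J" using J1 K by linarith
      have "J powi (int n - 1) = J ^ n / J"
        using J0 by (simp add: power_int_diff)
      also have "\<dots> \<le> (4 * K) ^ n / (K / 2)"
        using J0 J1 J2 K by (intro frac_le power_mono) auto
      finally have 1: "\<bar>J powi (int n - 1)\<bar> \<le> (4 * K) ^ n / (K / 2)"
        using J0 by simp
      have "\<bar>F\<bar> \<le> \<bar>- A / r ^ n\<bar> * (9 * B\<^sup>2)"
        unfolding F_def S_def using ij
        by (intro tensor_sum_bound B van finite_cells_core) auto
      also have "\<dots> = A / r ^ n * (9 * B\<^sup>2)" using r \<open>0 \<le> A\<close> by simp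
      also have "\<dots> \<le> D * K / K ^ n * (9 * B\<^sup>2)"
        using A[OF n] by (intro mult_right_mono) auto
      finally have 2: "\<bar>F\<bar> \<le> D * K / K ^ n * (9 * B\<^sup>2)" .
      have "\<bar>J powi (int n - 1) * F\<bar> \<le> (4 * K) ^ n / (K / 2) * (D * K / K ^ n * (9 * B\<^sup>2))"
        unfolding abs_mult using 1 2 K by (intro mult_mono) auto
      also have "\<dots> = 4 ^ n * (18 * D * B\<^sup>2)"
        using K by (simp add: power_mult_distrib field_simps)
      also have "\<dots> \<le> 4 ^ 3 * (18 * D * B\<^sup>2)"
        using n D by (intro mult_right_mono power_increasing) auto
      finally show ?thesis unfolding F by (simp add: J_def n_def)
    qed
  qed
  moreover have "finite {(i, j). i + j \<le> (3::nat)}"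
    by (rule finite_subset[of _ "{..3} \<times> {..3}"]) auto
  moreover have "{(i, j). i + j \<le> (3::nat)} \<noteq> {}" by (auto intro!: exI[of _ 0])
  ultimately show ?thesis
    unfolding S13_norm_def by (subst Max_le_iff) (auto intro!: cSUP_least simp del: Collect_empty_eq)
qed

text \<open>With \<open>r\<close> of size \<open>K M\<^sup>-\<^sup>n\<close> the porosity of \<open>Y\<close> applies through \<open>n\<close> subdivision
  steps, starting from intervals of length \<open>K/2\<close>, eight of which cover \<open>[-2 K, 2 K]\<close>.\<close>

lemma weight_xray_growth_le:
  fixes M n :: nat
  assumes por: "porous_on_lines \<nu> Y 1 \<Lambda>" and \<Lambda>: "Y \<inter> core K \<noteq> {} \<Longrightarrow> K / 2 \<le> \<Lambda>"
    and M: "2 < \<nu> * M" "0 < M" and n: "real M ^ n \<le> K / 2" and K: "0 < K"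
    and r: "r = K / (16 * real M ^ n)" and A: "0 \<le> A"
    and B: "\<And>u. \<bar>bump u\<bar> \<le> B"
  shows "xray_growth (weight K r A Y) \<le> 144 * A * B\<^sup>2 / K * ((real M - 1) / M) ^ n"
proof -
  define W where "W = weight K r A Y"
  have Mn: "1 \<le> real M ^ n" using M by (intro one_le_power) auto
  then have r': "0 < r" "16 * r \<le> K"
    using K M unfolding r by (auto simp: field_simps)
  have cont: "continuous_on UNIV W"
    using C_diff_tensor_sum[OF smooth_real_bump smooth_real_bump, of 0] unfolding W_def weight_def by simp
  define m where "m = ((real M - 1) / M) ^ n"
  have m0: "0 \<le> m" using M by (simp add: m_def)
  have meas: "measure lborel ({t. W (vector [t * cos \<theta>, t * sin \<theta>]) \<noteq> 0} \<inter> {- 2 * K..2 * K}) \<le> 4 * K * m" for \<theta>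
  proof (cases "Y \<inter> core K = {}")
    case True
    then show ?thesis using K m0 by (simp add: W_def weight_eq_0)
  next
    case False
    define e :: "real^2" where "e = vector [cos \<theta>, sin \<theta>]"
    have v: "vector [t * cos \<theta>, t * sin \<theta>] = t *\<^sub>R e" for t
      by (simp add: e_def vec_eq_iff forall_2)
    have e: "norm e = 1" by (simp add: norm_vec_def L2_set_def sum_2 e_def)
    define E where "E = {t. W (t *\<^sub>R e) \<noteq> 0}"
    have "continuous_on UNIV (\<lambda>t. W (t *\<^sub>R e))"
      by (intro continuous_on_compose2[OF cont] continuous_intros) auto
    then have E: "E \<in> sets borel"
      unfolding E_def by (intro borel_open open_Collect_neq) auto
    have near: "\<exists>y\<in>Y. dist (t *\<^sub>R e) y \<le> 3 * r" if t: "t \<in> E" for t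
    proof -
      from t have "tensor_sum r (cells_meeting r (Y \<inter> core K)) (- A) bump bump (t *\<^sub>R e) \<noteq> 0"
        by (simp add: E_def W_def weight_def)
      from tensor_sum_cells_nonzero[OF this r'(1) bump_vanishes bump_vanishes]
      show ?thesis by blast
    qed
    \<comment> \<open>the length of the intervals that are divided in the last step\<close>
    define l where "l = K / 2 * M / M ^ n"
    have "1 \<le> K / 2 / real M ^ n" using n Mn M by (simp add: le_divide_eq)
    then have "1 * 1 \<le> K / 2 / real M ^ n * M" using M K by (intro mult_mono) auto
    then have l: "1 \<le> l" by (simp add: l_def)
    have d: "2 * (3 * r) \<le> \<nu> * l"
    proof -
      have "K / M ^ n * (3/8) \<le> K / M ^ n * (\<nu> * M / 2)"
        using K M by (intro mult_left_mono) auto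
      then show ?thesis unfolding l_def r by (simp add: mult_ac)
    qed
    have \<nu>: "0 < \<nu>" using M by (metis less_trans mult_le_0_iff not_less of_nat_0_le_iff zero_less_numeral)
    have gap: "\<exists>i<M. E \<inter> {a + real i * (L / M) .. a + real i * (L / M) + L / M} = {}"
      if L: "l \<le> L" "L \<le> \<Lambda>" for a L
    proof (rule porous_on_lines_gap[OF por _ L(2) e near _ M])
      show "1 \<le> L" using l L by linarith
      show "2 * (3 * r) \<le> \<nu> * L" using d L \<nu> by (meson mult_left_mono less_imp_le order_trans)
    qed
    have "measure lborel (E \<inter> {a..a + K / 2}) \<le> m * (K / 2)" for a
      unfolding m_def
      using K l M \<Lambda>[OF False] by (intro measure_le_of_gaps[OF E _ _ gap]) (auto simp: l_def)
    from measure_chain_le[OF E this, of "- 2 * K" 8]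
    show ?thesis using K by (simp add: v E_def mult_ac)
  qed
  have "\<bar>W x\<bar> \<le> \<bar>- A\<bar> * (9 * B\<^sup>2)" for x
    unfolding W_def weight_def
    by (intro tensor_sum_bound B bump_vanishes finite_cells_core)
  then have lower: "- (A * (9 * B\<^sup>2)) \<le> W x" for x
    using A by (simp add: abs_le_iff) (metis minus_le_iff)
  have "xray_growth W \<le> 4 * (A * (9 * B\<^sup>2)) / K\<^sup>2 * (4 * K * m)"
    using lower A meas tensor_sum_core_nonzero[where f = bump and g = bump, OF _ r' bump_vanishes bump_vanishes]
    by (intro xray_growth_le cont K) (auto simp: W_def weight_def)
  also have "\<dots> = 144 * A * B\<^sup>2 / K * m"
    using K by (simp add: power2_eq_square)
  finally show ?thesis by (simp add: W_def m_def)
qed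

lemma power_bracket:
  fixes b x :: real
  assumes "1 < b" "1 \<le> x"
  obtains n where "b ^ n \<le> x" "x < b ^ Suc n"
proof -
  define n where "n = (LEAST n. x < b ^ Suc n)"
  obtain m where "x < b ^ m" using real_arch_pow[OF assms(1)] by blast
  also have "b ^ m \<le> b ^ Suc m" using assms by (intro power_increasing) auto
  finally have *: "x < b ^ Suc n" unfolding n_def by (rule LeastI)
  have "b ^ n \<le> x"
  proof (cases n)
    case (Suc l)
    then have "\<not> x < b ^ Suc l" unfolding n_def by (intro not_less_Least) simp
    then show ?thesis using Suc by simp
  qed (use assms in auto)
  with * show thesis by (rule that[rotated])
qed

section \<open>Summation over the scales\<close>

theorem theorem3:
  fixes \<nu> :: real
  assumes "0 < \<nu>" and "\<nu> < 1/10"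
  shows "\<exists>C_reg C_gr \<alpha> :: real. C_reg \<ge> 0 \<and> C_gr \<ge> 0 \<and> 0 < \<alpha> \<and> \<alpha> < 1 \<and>
    (\<forall>(h::real) (Y :: (real^2) set).
       0 < h \<and> h < 1/100 \<and> Y \<subseteq> ball 0 (1/h) \<and> porous_on_lines \<nu> Y 1 (1/h) \<longrightarrow>
       (\<exists>(\<omega> :: real^2 \<Rightarrow> real) (w :: nat \<Rightarrow> real^2 \<Rightarrow> real).
          (\<forall>x. \<omega> x = (\<Sum>\<^sub>\<infinity>k\<in>{1..}. w k x)) \<and>
          (\<forall>k\<ge>1. w k \<in> Cc_infinity \<and> (\<forall>x. w k x \<le> 0)) \<and>
          (\<exists>K. \<forall>k\<ge>K. \<forall>x. w k x = 0) \<and>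
          (\<forall>k\<ge>1. supp (w k) \<subseteq> {x. 2 ^ (k - 1) \<le> norm x \<and> norm x \<le> 2 ^ (k + 1)}) \<and>
          (\<forall>k\<ge>1. S13_norm (w k) \<le> C_reg) \<and>
          (\<Sum>\<^sub>\<infinity>k\<in>{1..}. xray_growth (w k)) \<le> C_gr \<and>
          (\<forall>x \<in> Y - ball 0 10. \<omega> x \<le> - norm x / (ln (norm x) powr \<alpha>))))"
proof -
  obtain M :: nat where "2 / \<nu> < M" using reals_Archimedean2 by blast
  then have M: "2 < \<nu> * M" using assms by (simp add: field_simps)
  have "\<nu> * M \<le> 1 * real M" using assms by (intro mult_right_mono) auto
  with M have M1: "1 < real M" by simp
  obtain B where B: "\<And>i u. i \<le> 3 \<Longrightarrow> \<bar>(deriv ^^ i) bump u\<bar> \<le> B" "0 \<le> B"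
    using bump_derivatives_bounded by blast
  define m where "m = (real M - 1) / M"
  have m: "0 < m" "m < 1" using M1 by (auto simp: m_def)
  \<comment> \<open>the gain from porosity as a power of the scale: refining the scale by the factor
    \<open>M\<close> reduces the measure by the factor \<open>m = M powr (-\<gamma>)\<close>\<close>
  define \<gamma> where "\<gamma> = - log M m"
  have \<gamma>: "0 < \<gamma>" using m M1 by (simp add: \<gamma>_def)
  have mM: "m = M powr (- \<gamma>)" using m M1 by (simp add: \<gamma>_def)
  \<comment> \<open>the requirements are \<open>\<alpha> < 1\<close> and \<open>\<alpha> (1 + \<gamma>/3) > 1\<close>\<close>
  define \<alpha> where "\<alpha> = 1 / (1 + \<gamma> / 6)"
  have \<alpha>: "0 < \<alpha>" "\<alpha> < 1" using \<gamma> by (auto simp: \<alpha>_def)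
  define p where "p = \<alpha> + \<alpha> * \<gamma> / 3"
  have p: "1 < p"
  proof -
    have "p = (1 + \<gamma> / 3) / (1 + \<gamma> / 6)"
      by (simp add: p_def \<alpha>_def add_divide_distrib)
    then show ?thesis using \<gamma> by (simp add: less_divide_eq)
  qed
  have summ: "summable (\<lambda>k::nat. real k powr (- p))"
    using p by (simp add: summable_real_powr_iff)
  define C where "C = 720 * B\<^sup>2 / m"
  have C: "0 \<le> C" using m by (simp add: C_def)
  have "\<exists>n. 1 \<le> k \<longrightarrow> real M ^ n \<le> real k powr (\<alpha> / 3) \<and> real k powr (\<alpha> / 3) < real M ^ Suc n" for k :: nat
  proof (cases "1 \<le> k")
    case True
    then have "1 \<le> real k powr (\<alpha> / 3)" using \<alpha> by (intro ge_one_powr_ge_zero) auto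
    with M1 show ?thesis using power_bracket by metis
  qed auto
  then obtain n where n: "\<And>k. 1 \<le> k \<Longrightarrow> real M ^ n k \<le> real k powr (\<alpha> / 3)"
      "\<And>k. 1 \<le> k \<Longrightarrow> real k powr (\<alpha> / 3) < real M ^ Suc (n k)"
    by metis
  \<comment> \<open>\<open>r k\<close> is of size \<open>2\<^sup>k k powr (-\<alpha>/3)\<close>, the finest scale compatible with three
    derivatives of a function of size \<open>A k\<close>; the \<open>16\<close> keeps bumps near \<open>core (2\<^sup>k)\<close> inside
    the prescribed annulus\<close>
  define r where "r k = 2 ^ k / (16 * real M ^ n k)" for k
  \<comment> \<open>\<open>norm x \<le> 3/2 \<cdot> 2\<^sup>k\<close> and \<open>ln (norm x) \<ge> k/3\<close> on the core, so any factor at least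
    \<open>9/2\<close> gives the lower bound on \<open>Y\<close>\<close>
  define A where "A k = 5 * 2 ^ k * real k powr (- \<alpha>)" for k :: nat
  have A0: "0 \<le> A k" for k by (simp add: A_def)
  have Mn1: "1 \<le> real M ^ n k" for k using M1 by (intro one_le_power) auto
  have r: "0 < r k" "16 * r k \<le> 2 ^ k" for k
    using M1 Mn1[of k] by (auto simp: r_def divide_le_eq)
  have Mn: "real M ^ n k \<le> 2 ^ k / 2" if k: "1 \<le> k" for k
  proof -
    have "real M ^ n k \<le> real k powr (\<alpha> / 3)" by (rule n(1)[OF k])
    also have "\<dots> \<le> real k powr 1" using k \<alpha> by (intro powr_mono) auto
    also have "\<dots> \<le> 2 ^ k / 2"
    proof -
      obtain l where l: "k = Suc l" using k by (cases k) auto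
      have "Suc l \<le> 2 ^ l" using less_exp[of l] by (rule Suc_leI)
      then have "real (Suc l) \<le> 2 ^ l" by (metis of_nat_le_iff of_nat_numeral of_nat_power)
      then show ?thesis using l by simp
    qed
    finally show ?thesis .
  qed
  have AD: "A k / r k ^ j \<le> 20480 * 2 ^ k / (2 ^ k) ^ j" if k: "1 \<le> k" and j: "j \<le> 3" for k j
  proof -
    have "(real M ^ n k) ^ j \<le> (real M ^ n k) ^ 3"
      using j Mn1 by (intro power_increasing) auto
    also have "\<dots> \<le> (real k powr (\<alpha> / 3)) ^ 3"
      using n(1)[OF k] by (intro power_mono) auto
    also have "\<dots> = real k powr \<alpha>"
      using k by (simp add: powr_power)
    finally have "real k powr (- \<alpha>) * (real M ^ n k) ^ j \<le> real k powr (- \<alpha>) * real k powr \<alpha>"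
      by (intro mult_left_mono) auto
    also have "\<dots> = 1" using k by (simp flip: powr_add)
    finally have 1: "real k powr (- \<alpha>) * (real M ^ n k) ^ j \<le> 1" .
    have 2: "(16::real) ^ j \<le> 16 ^ 3" using j by (intro power_increasing) auto
    have "A k / r k ^ j = 5 * 2 ^ k / (2 ^ k) ^ j * (16 ^ j * (real k powr (- \<alpha>) * (real M ^ n k) ^ j))"
      by (simp add: A_def r_def power_divide power_mult_distrib)
    also have "\<dots> \<le> 5 * 2 ^ k / (2 ^ k) ^ j * (16 ^ 3 * 1)"
      using 1 2 by (intro mult_left_mono mult_mono) auto
    finally show ?thesis by simp
  qed
  have mn: "m ^ n k \<le> real k powr (- (\<alpha> * \<gamma> / 3)) / m" if k: "1 \<le> k" for k
  proof -
    have "m ^ Suc (n k) = (real M ^ Suc (n k)) powr (- \<gamma>)"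
    proof -
      have "(real M ^ Suc (n k)) powr (- \<gamma>) = (real M powr real (Suc (n k))) powr (- \<gamma>)"
        using M1 by (subst powr_realpow) auto
      also have "\<dots> = (real M powr (- \<gamma>)) powr real (Suc (n k))"
        by (simp only: powr_powr mult.commute)
      also have "\<dots> = m ^ Suc (n k)"
        unfolding mM[symmetric] using m(1) by (rule powr_realpow)
      finally show ?thesis by simp
    qed
    also have "\<dots> \<le> (real k powr (\<alpha> / 3)) powr (- \<gamma>)"
      using n(2)[OF k] k \<gamma> by (intro powr_mono2') auto
    also have "\<dots> = real k powr (- (\<alpha> * \<gamma> / 3))"
      by (simp add: powr_powr)
    finally show ?thesis using m by (simp add: field_simps)
  qed
  show ?thesis
  proof (rule exI[of _ "1152 * 20480 * B\<^sup>2"], rule exI[of _ "C * (\<Sum>k. real k powr (- p))"],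
      rule exI[of _ \<alpha>], intro conjI allI impI)
    show "0 \<le> C * (\<Sum>k. real k powr (- p))"
      using C summ by (intro mult_nonneg_nonneg suminf_nonneg) auto
  next
    fix h :: real and Y :: "(real^2) set"
    assume "0 < h \<and> h < 1/100 \<and> Y \<subseteq> ball 0 (1/h) \<and> porous_on_lines \<nu> Y 1 (1/h)"
    then have h: "0 < h" and Y: "Y \<subseteq> ball 0 (1/h)" and por: "porous_on_lines \<nu> Y 1 (1/h)"
      by auto
    define w where "w k = weight (2 ^ k) (r k) (A k) Y" for k
    have core: "3/4 * 2 ^ k < 1/h" if "Y \<inter> core (2 ^ k) \<noteq> {}" for k
    proof -
      from that obtain y where "y \<in> Y" "y \<in> core (2 ^ k)" by blast
      then show ?thesis using Y by (auto simp: core_def)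
    qed
    obtain k0 where k0: "2 * (1 / h) < 2 ^ k0" using real_arch_pow[of 2] by auto
    have empty: "Y \<inter> core (2 ^ k) = {}" if "k0 \<le> k" for k
    proof (rule ccontr)
      assume "Y \<inter> core (2 ^ k) \<noteq> {}"
      moreover have "(2::real) ^ k0 \<le> 2 ^ k" using that by (intro power_increasing) auto
      moreover have "0 < 1 / h" using h by simp
      ultimately show False using core[of k] k0 by linarith
    qed
    have w0: "w k = (\<lambda>x. 0)" if "k0 \<le> k" for k
      using empty[OF that] by (auto simp: w_def weight_eq_0)
    have growth0: "xray_growth (\<lambda>x. 0) = 0"
      by (simp add: xray_growth_def xray_def)
    have growth: "xray_growth (w k) \<le> C * real k powr (- p)" if k: "1 \<le> k" for k
    proof -
      have "xray_growth (w k) \<le> 144 * A k * B\<^sup>2 / 2 ^ k * ((real M - 1) / M) ^ n k"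
        unfolding w_def
      proof (rule weight_xray_growth_le[OF por _ M _ Mn[OF k] _ r_def A0])
        show "2 ^ k / 2 \<le> 1 / h" if "Y \<inter> core (2 ^ k) \<noteq> {}"
          using core[OF that] zero_le_power[of "2::real" k] by linarith
        show "\<bar>bump u\<bar> \<le> B" for u using B(1)[of 0 u] by simp
      qed (use M1 in auto)
      also have "\<dots> = 720 * B\<^sup>2 * real k powr (- \<alpha>) * m ^ n k"
        by (simp add: A_def m_def)
      also have "\<dots> \<le> 720 * B\<^sup>2 * real k powr (- \<alpha>) * (real k powr (- (\<alpha> * \<gamma> / 3)) / m)"
        using mn[OF k] by (intro mult_left_mono) auto
      also have "\<dots> = C * (real k powr (- \<alpha>) * real k powr (- (\<alpha> * \<gamma> / 3)))"
        by (simp add: C_def)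
      also have "\<dots> = C * real k powr (- p)"
        by (simp add: p_def flip: powr_add)
      finally show ?thesis .
    qed
    define \<omega> where "\<omega> x = (\<Sum>\<^sub>\<infinity>k\<in>{1..}. w k x)" for x
    have \<omega>: "\<omega> x = (\<Sum>k\<in>{1..<k0}. w k x)" for x
    proof -
      have "\<omega> x = (\<Sum>\<^sub>\<infinity>k\<in>{1..<k0}. w k x)"
        unfolding \<omega>_def by (rule infsum_cong_neutral) (auto simp: w0)
      then show ?thesis by simp
    qed
    have sum_growth: "(\<Sum>\<^sub>\<infinity>k\<in>{1..}. xray_growth (w k)) \<le> C * (\<Sum>k. real k powr (- p))"
    proof -
      have "(\<Sum>\<^sub>\<infinity>k\<in>{1..}. xray_growth (w k)) = (\<Sum>\<^sub>\<infinity>k\<in>{1..<k0}. xray_growth (w k))"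
        by (rule infsum_cong_neutral) (auto simp: w0 growth0)
      also have "\<dots> = (\<Sum>k\<in>{1..<k0}. xray_growth (w k))" by simp
      also have "\<dots> \<le> (\<Sum>k\<in>{1..<k0}. C * real k powr (- p))"
        by (intro sum_mono growth) auto
      also have "\<dots> = C * (\<Sum>k\<in>{1..<k0}. real k powr (- p))"
        by (simp add: sum_distrib_left)
      also have "\<dots> \<le> C * (\<Sum>k. real k powr (- p))"
        using C summ by (intro mult_left_mono sum_le_suminf) auto
      finally show ?thesis .
    qed
    have lower: "\<omega> x \<le> - norm x / (ln (norm x) powr \<alpha>)" if x: "x \<in> Y - ball 0 10" for x
    proof -
      have x10: "10 \<le> norm x" using x by simp
      then obtain k where k: "2 ^ k \<le> 4/3 * norm x" "4/3 * norm x < 2 ^ Suc k"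
        using power_bracket[of 2 "4/3 * norm x"] by auto
      then have xc: "x \<in> core (2 ^ k)" by (simp add: core_def)
      have "k \<noteq> 0" using k x10 by (intro notI) simp
      then have k1: "1 \<le> k" by simp
      have "k < k0" 
        using empty[of k] x xc by (cases "k0 \<le> k") auto
      have "real k / 3 \<le> ln (norm x)"
      proof -
        have "ln (4/3) \<le> (4/3::real) - 1" by (rule ln_le_minus_one) simp
        moreover have "real k * ln 2 \<le> ln (4/3) + ln (norm x)"
        proof -
          have "real k * ln 2 = ln (2 ^ k :: real)" by (simp add: ln_realpow)
          also have "\<dots> \<le> ln (4/3 * norm x)" using k x10 by (subst ln_le_cancel_iff) auto
          also have "\<dots> = ln (4/3) + ln (norm x)" using x10 by (subst ln_mult_pos) auto
          finally show ?thesis .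
        qed
        moreover have "real k * (2/3) \<le> real k * ln 2"
          using ln2_ge_two_thirds by (intro mult_left_mono) auto
        moreover have "1 \<le> real k" using k1 by simp
        ultimately show ?thesis by linarith
      qed
      then have "(real k / 3) powr \<alpha> \<le> ln (norm x) powr \<alpha>"
        using \<alpha> by (intro powr_mono2) auto
      then have "norm x / (ln (norm x) powr \<alpha>) \<le> (3/2 * 2 ^ k) / (real k / 3) powr \<alpha>"
        using k k1 by (intro frac_le) auto
      also have "\<dots> = 3/2 * 2 ^ k * real k powr (- \<alpha>) * 3 powr \<alpha>"
        by (simp add: powr_divide powr_minus divide_simps)
      also have "\<dots> \<le> 3/2 * 2 ^ k * real k powr (- \<alpha>) * 3 powr 1"
        using \<alpha> by (intro mult_left_mono powr_mono) auto
      also have "\<dots> \<le> A k" by (simp add: A_def)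
      finally have 1: "norm x / (ln (norm x) powr \<alpha>) \<le> A k" .
      have "- w k x \<le> (\<Sum>k\<in>{1..<k0}. - w k x)"
        using k1 \<open>k < k0\<close>
        by (intro member_le_sum) (auto simp: w_def weight_nonpos A0)
      then have "\<omega> x \<le> w k x" by (simp add: \<omega> sum_negf)
      also have "\<dots> \<le> - A k"
        using weight_le[OF A0 _ xc] x by (simp add: w_def)
      finally show ?thesis using 1 by simp
    qed
    have smooth: "w k \<in> Cc_infinity" for k
      unfolding w_def by (rule weight_Cc_infinity[OF r])
    have neg: "w k x \<le> 0" for k x
      unfolding w_def by (rule weight_nonpos[OF A0])
    have supp: "supp (w k) \<subseteq> {x. 2 ^ (k - 1) \<le> norm x \<and> norm x \<le> 2 ^ (k + 1)}" if "1 \<le> k" for k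
    proof -
      have "(2::real) ^ (k - 1) = 2 ^ k / 2" using that by (cases k) auto
      moreover have "(2::real) ^ (k + 1) = 2 * 2 ^ k" by simp
      ultimately show ?thesis
        using weight_supp[OF r[of k], of "A k" Y] unfolding w_def by metis
    qed
    have S13: "S13_norm (w k) \<le> 1152 * 20480 * B\<^sup>2" if "1 \<le> k" for k
      unfolding w_def by (rule weight_S13_norm_le[OF B(1) _ r A0 _ AD[OF that]]) auto
    show "\<exists>(\<omega> :: real^2 \<Rightarrow> real) (w :: nat \<Rightarrow> real^2 \<Rightarrow> real).
          (\<forall>x. \<omega> x = (\<Sum>\<^sub>\<infinity>k\<in>{1..}. w k x)) \<and>
          (\<forall>k\<ge>1. w k \<in> Cc_infinity \<and> (\<forall>x. w k x \<le> 0)) \<and>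
          (\<exists>K. \<forall>k\<ge>K. \<forall>x. w k x = 0) \<and>
          (\<forall>k\<ge>1. supp (w k) \<subseteq> {x. 2 ^ (k - 1) \<le> norm x \<and> norm x \<le> 2 ^ (k + 1)}) \<and>
          (\<forall>k\<ge>1. S13_norm (w k) \<le> 1152 * 20480 * B\<^sup>2) \<and>
          (\<Sum>\<^sub>\<infinity>k\<in>{1..}. xray_growth (w k)) \<le> C * (\<Sum>k. real k powr (- p)) \<and>
          (\<forall>x \<in> Y - ball 0 10. \<omega> x \<le> - norm x / (ln (norm x) powr \<alpha>))"
      using smooth neg supp S13 sum_growth lower w0
      by (intro exI[of _ \<omega>] exI[of _ w] conjI allI impI ballI exI[of _ k0]) (auto simp: \<omega>_def)
  qed (use \<alpha> B in auto)
qed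

end
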